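(* Every double extension of a metric Abelian Lie algebra is Ricci-parallel.
   Context: A metric Lie algebra $(\mathfrak{g},\langle\cdot,\cdot\rangle)$ is a finite-dimensional real Lie algebra $\mathfrak{g}$ with a nondegenerate symmetric bilinear form (of arbitrary signature); it is a metric Abelian Lie algebra if $\mathfrak{g}$ is Abelian. Its Levi-Civita connection is the bilinear map $\nabla$ given by $2\langle\nabla_xy,z\rangle=\langle[x,y],z\rangle+\langle[z,x],y\rangle+\langle x,[z,y]\rangle$. Its curvature is $R(x,y)z=\nabla_x\nabla_yz-\nabla_y\nabla_xz-\nabla_{[x,y]}z$ and its Ricci tensor is $\mathrm{ric}(x,y)=\mathrm{tr}(\xi\mapsto R(\xi,x)y)$. It is Ricci-parallel if $\nabla\mathrm{ric}=0$, i.e. $\mathrm{ric}(\nabla_xy,z)+\mathrm{ric}(y,\nabla_xz)=0$ for all $x,y,z$. Double extension: a metric Lie algebra $(\mathfrak{g},\langle\cdot,\cdot\rangle)$ is a double extension of a metric Lie algebra $(\mathfrak{g}_0,[\cdot,\cdot]_0,\langle\cdot,\cdot\rangle_0)$ if there are $D,K\in\mathrm{End}(\mathfrak{g}_0)$, $L\in\mathfrak{g}_0$ such that $\mathfrak{g}=\mathbb{R}u\oplus\mathbb{R}v\oplus\mathfrak{g}_0$ as a vector space, the Lie bracket of $\mathfrak{g}$ is $$[u,e]=D(e)+\langle L,e\rangle_0v,\quad [e,e']=[e,e']_0+\langle K(e),e'\rangle_0v,\quad [\mathfrak{g},v]=0\qquad(e,e'\in\mathfrak{g}_0)$$ (the data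 are such that this is a Lie bracket), and the metric satisfies $\langle u,v\rangle=1$, $\langle u,u\rangle=\langle v,v\rangle=0$, $\langle u,\mathfrak{g}_0\rangle=\langle v,\mathfrak{g}_0\rangle=0$, $\langle\cdot,\cdot\rangle|_{\mathfrak{g}_0}=\langle\cdot,\cdot\rangle_0$. *)

theory Defs
  imports "HOL-Analysis.Analysis"
begin

text \<open>Lie algebras live on whole types of class \<^class>\<open>real_vector\<close>. Finite dimension is an explicit
  assumption because \<^class>\<open>euclidean_space\<close> would exclude dimension 0 and carries a preferred
  positive definite inner product.\<close>

definition lie_algebra :: "('g::real_vector \<Rightarrow> 'g \<Rightarrow> 'g) \<Rightarrow> bool" where
  "lie_algebra br \<longleftrightarrow>
     (\<exists>B::'g set. finite B \<and> span B = UNIV) \<and>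
     bilinear br \<and>
     (\<forall>x. br x x = 0) \<and>
     (\<forall>x y z. br x (br y z) + br y (br z x) + br z (br x y) = 0)"

definition metric_lie_algebra ::
    "('g::real_vector \<Rightarrow> 'g \<Rightarrow> 'g) \<Rightarrow> ('g \<Rightarrow> 'g \<Rightarrow> real) \<Rightarrow> bool" where
  "metric_lie_algebra br g \<longleftrightarrow>
     lie_algebra br \<and>
     bilinear g \<and>
     (\<forall>x y. g x y = g y x) \<and>
     (\<forall>x. (\<forall>y. g x y = 0) \<longrightarrow> x = 0)"

definition metric_abelian_lie_algebra ::
    "('g::real_vector \<Rightarrow> 'g \<Rightarrow> 'g) \<Rightarrow> ('g \<Rightarrow> 'g \<Rightarrow> real) \<Rightarrow> bool" where
  "metric_abelian_lie_algebra br g \<longleftrightarrow>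
     metric_lie_algebra br g \<and> (\<forall>x y. br x y = 0)"

definition levi_civita ::
    "('g::real_vector \<Rightarrow> 'g \<Rightarrow> 'g) \<Rightarrow> ('g \<Rightarrow> 'g \<Rightarrow> real) \<Rightarrow> 'g \<Rightarrow> 'g \<Rightarrow> 'g" where
  "levi_civita br g x y =
     (THE w. \<forall>z. 2 * g w z = g (br x y) z + g (br z x) y + g x (br z y))"

definition curvature ::
    "('g::real_vector \<Rightarrow> 'g \<Rightarrow> 'g) \<Rightarrow> ('g \<Rightarrow> 'g \<Rightarrow> real) \<Rightarrow> 'g \<Rightarrow> 'g \<Rightarrow> 'g \<Rightarrow> 'g" where
  "curvature br g x y z =
     levi_civita br g x (levi_civita br g y z)
     - levi_civita br g y (levi_civita br g x z)
     - levi_civita br g (br x y) z"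

text \<open>The trace of an endomorphism of a finite-dimensional space; the choice of basis is
  immaterial for linear maps (lemma \<open>endo_trace_eq\<close>).\<close>

definition endo_trace :: "('g::real_vector \<Rightarrow> 'g) \<Rightarrow> real" where
  "endo_trace f =
     (let B = (SOME B. independent B \<and> span B = UNIV) in \<Sum>b\<in>B. representation B (f b) b)"

definition ricci ::
    "('g::real_vector \<Rightarrow> 'g \<Rightarrow> 'g) \<Rightarrow> ('g \<Rightarrow> 'g \<Rightarrow> real) \<Rightarrow> 'g \<Rightarrow> 'g \<Rightarrow> real" where
  "ricci br g x y = endo_trace (\<lambda>\<xi>. curvature br g \<xi> x y)"

definition ricci_parallel ::
    "('g::real_vector \<Rightarrow> 'g \<Rightarrow> 'g) \<Rightarrow> ('g \<Rightarrow> 'g \<Rightarrow> real) \<Rightarrow> bool" where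
  "ricci_parallel br g \<longleftrightarrow>
     (\<forall>x y z. ricci br g (levi_civita br g x y) z + ricci br g y (levi_civita br g x z) = 0)"

text \<open>The inclusion of \<open>\<gg>\<^sub>0\<close> into \<open>\<gg> = \<real>u \<oplus> \<real>v \<oplus> \<gg>\<^sub>0\<close> is the linear map \<open>\<iota>\<close>, which the
  decomposition condition forces to be injective.\<close>

definition double_extension ::
    "('h::real_vector \<Rightarrow> 'h \<Rightarrow> 'h) \<Rightarrow> ('h \<Rightarrow> 'h \<Rightarrow> real) \<Rightarrow>
     ('g::real_vector \<Rightarrow> 'g \<Rightarrow> 'g) \<Rightarrow> ('g \<Rightarrow> 'g \<Rightarrow> real) \<Rightarrow> bool" where
  "double_extension br0 g0 br g \<longleftrightarrow>
     metric_lie_algebra br0 g0 \<and> metric_lie_algebra br g \<and>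
     (\<exists>(D::'h \<Rightarrow> 'h) (K::'h \<Rightarrow> 'h) (L::'h) (u::'g) (v::'g) (\<iota>::'h \<Rightarrow> 'g).
        linear D \<and> linear K \<and> linear \<iota> \<and>
        bij (\<lambda>(a::real, b::real, e::'h). a *\<^sub>R u + b *\<^sub>R v + \<iota> e) \<and>
        (\<forall>e. br u (\<iota> e) = \<iota> (D e) + g0 L e *\<^sub>R v) \<and>
        (\<forall>e e'. br (\<iota> e) (\<iota> e') = \<iota> (br0 e e') + g0 (K e) e' *\<^sub>R v) \<and>
        (\<forall>x. br x v = 0) \<and>
        g u v = 1 \<and> g u u = 0 \<and> g v v = 0 \<and>
        (\<forall>e. g u (\<iota> e) = 0 \<and> g v (\<iota> e) = 0) \<and>
        (\<forall>e e'. g (\<iota> e) (\<iota> e') = g0 e e'))"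

lemma representation_fixed_coord:
  fixes B :: "'g::real_vector set"
  assumes "independent B" "span B = UNIV"
  shows "linear (\<lambda>x. representation B x b)"
  using assms by (intro linearI) (simp_all add: representation_add representation_scale)

lemma endo_trace_eq:
  fixes f :: "'g::real_vector \<Rightarrow> 'g"
  assumes f: "linear f" and fin: "\<exists>S::'g set. finite S \<and> span S = UNIV"
    and B: "independent B" "span B = UNIV"
  shows "endo_trace f = (\<Sum>b\<in>B. representation B (f b) b)"
proof -
  define C :: "'g set" where "C = (SOME B. independent B \<and> span B = UNIV)"
  have C: "independent C" "span C = UNIV"
    using someI[of "\<lambda>B. independent B \<and> span B = UNIV" B] B unfolding C_def by auto
  obtain S :: "'g set" where S: "finite S" "span S = UNIV" using fin by blast
  have finB: "finite B" and finC: "finite C"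
    using independent_span_bound[OF S(1)] B C S(2) by auto
  have expand: "(\<Sum>b\<in>A. representation A x b *\<^sub>R b) = x"
    if "finite A" "independent A" "span A = UNIV" for A and x :: 'g
    using that by (intro real_vector.sum_representation_eq) auto
  have 1: "representation B (f b) b = (\<Sum>c\<in>C. representation C (f b) c * representation B c b)" for b
  proof -
    have "representation B (f b) b = representation B (\<Sum>c\<in>C. representation C (f b) c *\<^sub>R c) b"
      by (simp add: expand[OF finC C])
    also have "\<dots> = (\<Sum>c\<in>C. representation C (f b) c * representation B c b)"
      by (simp add: linear_sum[OF representation_fixed_coord[OF B]]
            linear_scale[OF representation_fixed_coord[OF B]])
    finally show ?thesis .
  qed
  have 2: "representation C (f c) c = (\<Sum>b\<in>B. representation C (f b) c * representation B c b)" for c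
  proof -
    have "representation C (f c) c = representation C (f (\<Sum>b\<in>B. representation B c b *\<^sub>R b)) c"
      by (simp add: expand[OF finB B])
    also have "\<dots> = (\<Sum>b\<in>B. representation C (f b) c * representation B c b)"
      by (simp add: linear_sum[OF f] linear_scale[OF f] linear_sum[OF representation_fixed_coord[OF C]]
            linear_scale[OF representation_fixed_coord[OF C]] mult.commute)
    finally show ?thesis .
  qed
  have "endo_trace f = (\<Sum>c\<in>C. representation C (f c) c)"
    by (simp add: endo_trace_def C_def Let_def)
  also have "\<dots> = (\<Sum>b\<in>B. representation B (f b) b)"
    unfolding 1 2 by (rule sum.swap)
  finally show ?thesis .
qed

lemma metric_riesz:
  fixes g :: "'g::real_vector \<Rightarrow> 'g \<Rightarrow> real"
  assumes m: "metric_lie_algebra br g" and \<phi>: "linear \<phi>"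
  shows "\<exists>!w. \<forall>z. g w z = \<phi> z"
proof -
  obtain S :: "'g set" where S: "finite S" "span S = UNIV"
    using m by (auto simp: metric_lie_algebra_def lie_algebra_def)
  obtain B where B0: "B \<subseteq> S" "independent B" "S \<subseteq> span B"
    by (rule maximal_independent_subset[of S])
  have B: "finite B" "independent B" "span B = UNIV"
  proof -
    show "finite B" using B0(1) S(1) by (rule finite_subset)
    have "span S \<subseteq> span B" using span_mono[OF B0(3)] by (simp only: span_span)
    then show "span B = UNIV" using S(2) by blast
  qed (fact B0(2))
  have bil: "bilinear g" and nd: "\<And>x. (\<forall>y. g x y = 0) \<Longrightarrow> x = 0"
    using m unfolding metric_lie_algebra_def by blast+
  have ext: "\<forall>z. p z = q z" if "linear p" "linear q" "\<And>b. b \<in> B \<Longrightarrow> p b = q b" for p q :: "'g \<Rightarrow> real"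
    using linear_eq_on[OF that(1,2), where B = B] that(3) B(3) by auto
  have lin: "linear (g x)" "linear (\<lambda>x. g x y)" for x y
    using bil unfolding bilinear_def by auto
  define T where "T x = (\<Sum>b\<in>B. g x b *\<^sub>R b)" for x
  have linT: "linear T"
    unfolding T_def
    by (intro linearI) (simp_all add: linear_add[OF lin(2)] linear_scale[OF lin(2)]
        scaleR_add_left sum.distrib scaleR_sum_right)
  have coef: "g x b = c b" if "T x = (\<Sum>b\<in>B. c b *\<^sub>R b)" "b \<in> B" for x b c
  proof -
    have "(\<Sum>b\<in>B. (g x b - c b) *\<^sub>R b) = 0"
      using that(1) unfolding T_def by (simp add: scaleR_diff_left sum_subtractf)
    then show ?thesis
      using independentD[OF B(2) B(1) order_refl, of "\<lambda>b. g x b - c b" b] that(2) by simp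
  qed
  have "x = 0" if "T x = 0" for x
  proof -
    have "g x b = 0" if "b \<in> B" for b
      using coef[of x "\<lambda>_. 0" b] \<open>T x = 0\<close> that by simp
    then show ?thesis
      using nd[of x] ext[OF lin(1)[of x], of "\<lambda>_. 0"] by (simp add: module_hom_zero)
  qed
  then have injT: "inj T" using linear_inj_iff_eq_0[OF linT] by blast
  interpret fd: finite_dimensional_vector_space "scaleR :: real \<Rightarrow> 'g \<Rightarrow> 'g" B
    by unfold_locales (use B in \<open>auto simp: dependent_raw_def span_raw_def
        algebra_simps\<close>)
  have "surj T"
    using fd.linear_inj_imp_surj[of T] linT injT by (simp add: linear_def)
  then obtain w where w: "T w = (\<Sum>b\<in>B. \<phi> b *\<^sub>R b)" by (metis surjD)
  have "\<forall>z. g w z = \<phi> z"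
    using ext[OF lin(1)[of w] \<phi>] coef[OF w] by blast
  moreover have "w1 = w2" if "\<forall>z. g w1 z = \<phi> z" "\<forall>z. g w2 z = \<phi> z" for w1 w2
    using nd[of "w1 - w2"] that by (simp add: linear_diff[OF lin(2)])
  ultimately show ?thesis by blast
qed

lemma levi_civita:
  fixes g :: "'g::real_vector \<Rightarrow> 'g \<Rightarrow> real"
  assumes m: "metric_lie_algebra br g"
  shows "2 * g (levi_civita br g x y) z = g (br x y) z + g (br z x) y + g x (br z y)"
proof -
  have g: "bilinear g" and br: "bilinear br"
    using m unfolding metric_lie_algebra_def lie_algebra_def by blast+
  define \<phi> where "\<phi> z = (g (br x y) z + g (br z x) y + g x (br z y)) / 2" for z
  have "linear \<phi>"
    unfolding \<phi>_def
    by (intro linearI)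
      (simp_all add: bilinear_ladd[OF g] bilinear_radd[OF g] bilinear_lmul[OF g] bilinear_rmul[OF g]
        bilinear_ladd[OF br] bilinear_lmul[OF br] field_simps)
  from metric_riesz[OF m this]
  have "\<exists>!w. \<forall>z. 2 * g w z = g (br x y) z + g (br z x) y + g x (br z y)"
    unfolding \<phi>_def by (simp add: field_simps)
  from theI'[OF this] show ?thesis
    unfolding levi_civita_def by blast
qed

end

theory Submission
  imports Defs
begin

text \<open>Let \<open>v\<close> span the central null line and let \<open>W = v\<^sup>\<bottom>\<close>. Since
  \<open>[\<gg>,\<gg>] \<subseteq> W\<close> and \<open>[W,W] \<subseteq> \<real>v\<close>, the vector \<open>v\<close> is parallel, \<open>\<nabla>\<^sub>v = 0\<close>, \<open>\<nabla>\<close> takes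
  values in \<open>W\<close>, and \<open>\<nabla>\<^sub>WW \<subseteq> \<real>v\<close>. Hence, if \<open>x \<in> W\<close> or \<open>y \<in> W\<close>, the endomorphism
  \<open>\<xi> \<mapsto> R(\<xi>,x)y\<close> shifts the flag \<open>0 \<subset> \<real>v \<subset> W \<subset> \<gg>\<close> down by one step and is traceless. So
  \<open>ric\<close> vanishes as soon as one argument lies in \<open>W\<close>, and \<open>\<nabla>ric = 0\<close> because \<open>\<nabla>\<close> takes
  values in \<open>W\<close>.\<close>

lemma metric_lie_algebraD:
  assumes "metric_lie_algebra br g"
  shows "bilinear br" "bilinear g" "br x x = 0" "g x y = g y x"
    and "(\<And>z. g x z = g y z) \<Longrightarrow> x = y"
proof -
  show g: "bilinear g" and "bilinear br" "br x x = 0" "g x y = g y x"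
    using assms unfolding metric_lie_algebra_def lie_algebra_def by blast+
  assume "\<And>z. g x z = g y z"
  then have "\<forall>z. g (x - y) z = 0" by (simp add: bilinear_lsub[OF g])
  then show "x = y" using assms unfolding metric_lie_algebra_def by fastforce
qed

lemma bracket_skew:
  assumes "metric_lie_algebra br g"
  shows "br y x = - br x y"
proof -
  note br = metric_lie_algebraD(1,3)[OF assms]
  have "br (x + y) (x + y) = 0" by (rule br(2))
  then have "br x y + br y x = 0"
    unfolding bilinear_ladd[OF br(1)] bilinear_radd[OF br(1)] by (simp add: br(2) add.commute)
  then show ?thesis by (simp add: add_eq_0_iff)
qed

lemma levi_civita_eqI:
  assumes "metric_lie_algebra br g"
    and "\<And>z. 2 * g w z = g (br x y) z + g (br z x) y + g x (br z y)"
  shows "levi_civita br g x y = w"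
proof (rule metric_lie_algebraD(5)[OF assms(1)])
  fix z show "g (levi_civita br g x y) z = g w z"
    using levi_civita[OF assms(1), of x y z] assms(2)[of z] by simp
qed

text \<open>The right side of the Koszul formula is bilinear in \<open>x\<close> and
  \<open>y\<close>, and nondegeneracy transfers this to the connection.\<close>

lemma bilinear_levi_civita:
  assumes m: "metric_lie_algebra br g"
  shows "bilinear (levi_civita br g)"
proof -
  note g = metric_lie_algebraD(2)[OF m] and br = metric_lie_algebraD(1)[OF m]
  note expand = bilinear_ladd[OF g] bilinear_radd[OF g] bilinear_lmul[OF g] bilinear_rmul[OF g]
    bilinear_ladd[OF br] bilinear_radd[OF br] bilinear_lmul[OF br] bilinear_rmul[OF br]
    distrib_left mult.left_commute[of 2] levi_civita[OF m]
  show ?thesis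
    unfolding bilinear_def
    by (intro conjI allI linearI; rule levi_civita_eqI[OF m]; simp add: expand algebra_simps)
qed

lemma linear_curvature:
  assumes m: "metric_lie_algebra br g"
  shows "linear (\<lambda>\<xi>. curvature br g \<xi> x y)"
proof -
  note n = bilinear_levi_civita[OF m] and br = metric_lie_algebraD(1)[OF m]
  show ?thesis
    unfolding curvature_def
    by (intro linearI)
      (simp_all add: bilinear_ladd[OF n] bilinear_radd[OF n] bilinear_lmul[OF n]
        bilinear_rmul[OF n] bilinear_ladd[OF br] bilinear_lmul[OF br] scaleR_diff_right)
qed

text \<open>The condition on \<open>f\<close> says that its matrix in the basis \<open>B\<close> has
  zero diagonal; no ordering of \<open>B\<close> is required.\<close>

lemma endo_trace_eq_0:
  fixes f :: "'g::real_vector \<Rightarrow> 'g"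
  assumes "linear f" "\<exists>S::'g set. finite S \<and> span S = UNIV"
    and B: "independent B" "span B = UNIV"
    and f: "\<And>b. b \<in> B \<Longrightarrow> f b \<in> span (B - {b})"
  shows "endo_trace f = 0"
proof -
  have "representation B (f b) b = 0" if "b \<in> B" for b
  proof -
    have "representation B (f b) = representation (B - {b}) (f b)"
      using B(1) f[OF that] by (rule representation_extend) auto
    then show ?thesis using representation_ne_zero by fastforce
  qed
  then show ?thesis by (simp add: endo_trace_eq[OF assms(1-4)])
qed

text \<open>The basis-free content of a double extension of a metric Abelian Lie algebra: the maps
  \<open>D\<close>, \<open>K\<close>, \<open>L\<close> and the vector \<open>u\<close> no longer
  appear.\<close>

locale central_null_vector =
  fixes br :: "'g::real_vector \<Rightarrow> 'g \<Rightarrow> 'g" and g :: "'g \<Rightarrow> 'g \<Rightarrow> real" and v :: 'g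
  assumes metric: "metric_lie_algebra br g"
    and v_nonzero: "v \<noteq> 0"
    and v_null: "g v v = 0"
    and v_central: "br x v = 0"
    and derived_orth: "g (br x y) v = 0"
    and orth_bracket: "\<lbrakk>g x v = 0; g y v = 0\<rbrakk> \<Longrightarrow> br x y \<in> span {v}"
begin

abbreviation nabla where "nabla \<equiv> levi_civita br g"

lemmas g = metric_lie_algebraD(2)[OF metric]
lemmas br = metric_lie_algebraD(1)[OF metric]
lemmas nabla = bilinear_levi_civita[OF metric]
lemmas g_commute = metric_lie_algebraD(4)[OF metric]
lemmas nondegenerate = metric_lie_algebraD(5)[OF metric]

lemma v_central': "br v x = 0"
  using bracket_skew[OF metric, of v x] v_central by simp

text \<open>In the Koszul formula two terms vanish because \<open>v\<close> is central, the third
  because brackets are orthogonal to \<open>v\<close>.\<close>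

lemma nabla_v_right: "nabla x v = 0"
  by (rule levi_civita_eqI[OF metric]) (simp add: v_central derived_orth bilinear_lzero[OF g] bilinear_rzero[OF g])

lemma nabla_v_left: "nabla v x = 0"
  using derived_orth g_commute
  by (intro levi_civita_eqI[OF metric]) (simp add: v_central v_central' bilinear_lzero[OF g] bilinear_rzero[OF g])

lemma nabla_span_right: "y \<in> span {v} \<Longrightarrow> nabla x y = 0"
  by (auto simp: span_singleton bilinear_rmul[OF nabla] nabla_v_right)

lemma nabla_span_left: "x \<in> span {v} \<Longrightarrow> nabla x y = 0"
  by (auto simp: span_singleton bilinear_lmul[OF nabla] nabla_v_left)

lemma nabla_orth: "g (nabla x y) v = 0"
  using levi_civita[OF metric, of x y v]
  by (simp add: v_central' derived_orth bilinear_lzero[OF g] bilinear_rzero[OF g])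

lemma dual_vector: obtains u where "g u v = 1"
proof -
  obtain z where "g v z \<noteq> 0"
    using v_nonzero nondegenerate[of v 0] by (auto simp: bilinear_lzero[OF g])
  then show thesis
    by (intro that[of "z /\<^sub>R g v z"]) (simp add: bilinear_lmul[OF g] g_commute[of z v])
qed

text \<open>Modulo \<open>W\<close> every vector is a multiple of \<open>u\<close>, so a functional
  vanishing on \<open>W\<close> is determined by its value at \<open>u\<close>.\<close>

lemma orth_orth:
  assumes w: "\<And>z. g z v = 0 \<Longrightarrow> g w z = 0"
  shows "w \<in> span {v}"
proof -
  obtain u where u: "g u v = 1" by (rule dual_vector)
  have "w = g w u *\<^sub>R v"
  proof (rule nondegenerate)
    fix z
    have "g (z - g z v *\<^sub>R u) v = 0"
      by (simp add: bilinear_lsub[OF g] bilinear_lmul[OF g] u)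
    from w[OF this] show "g w z = g (g w u *\<^sub>R v) z"
      by (simp add: bilinear_rsub[OF g] bilinear_rmul[OF g] bilinear_lmul[OF g] g_commute[of v z])
  qed
  then show ?thesis by (auto simp: span_singleton)
qed

lemma g_span_left: "\<lbrakk>w \<in> span {v}; g z v = 0\<rbrakk> \<Longrightarrow> g w z = 0"
  by (auto simp: span_singleton bilinear_lmul[OF g] g_commute[of v])

text \<open>Tested against \<open>z\<close> in \<open>W\<close>, every bracket in the Koszul formula
  is a multiple of \<open>v\<close>, hence orthogonal to \<open>W\<close>.\<close>

lemma nabla_orth_orth:
  assumes "g x v = 0" "g y v = 0"
  shows "nabla x y \<in> span {v}"
proof (rule orth_orth)
  fix z assume "g z v = 0"
  then show "g (nabla x y) z = 0"
    using levi_civita[OF metric, of x y z] assms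
    by (simp add: orth_bracket g_span_left g_commute[of x "br z y"])
qed

lemma curvature_orth: "g (curvature br g x y z) v = 0"
  by (simp add: curvature_def bilinear_lsub[OF g] nabla_orth)

lemma curvature_v: "curvature br g v x y = 0"
  by (simp add: curvature_def nabla_v_left v_central' bilinear_rzero[OF nabla] bilinear_lzero[OF nabla])

lemma curvature_span:
  assumes "g w v = 0" "g x v = 0 \<or> g y v = 0"
  shows "curvature br g w x y \<in> span {v}"
proof -
  have "nabla w (nabla x y) \<in> span {v}"
    using assms(1) nabla_orth by (rule nabla_orth_orth)
  \<comment> \<open>If \<open>x\<close> is in \<open>W\<close>, then so are both arguments of the
    outer \<open>nabla\<close>. Otherwise \<open>y\<close> is in \<open>W\<close>, and the inner
    term is a multiple of the parallel vector \<open>v\<close>.\<close>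
  moreover have "nabla x (nabla w y) \<in> span {v}"
    using assms nabla_orth nabla_orth_orth nabla_span_right span_zero by metis
  \<comment> \<open>If \<open>x\<close> is in \<open>W\<close>, then \<open>br w x\<close> is a
    multiple of \<open>v\<close> and its \<open>nabla\<close> is zero. Otherwise
    \<open>br w x\<close> and \<open>y\<close> both lie in \<open>W\<close>.\<close>
  moreover have "nabla (br w x) y \<in> span {v}"
    using assms derived_orth nabla_orth_orth orth_bracket nabla_span_left span_zero by metis
  ultimately show ?thesis unfolding curvature_def by (intro span_diff)
qed

lemma ricci_eq_0:
  assumes "g x v = 0 \<or> g y v = 0"
  shows "ricci br g x y = 0"
proof -
  define W where "W = {w. g w v = 0}"
  \<comment> \<open>A basis adapted to the flag: \<open>v\<close> is extended to a basis
    \<open>C\<close> of \<open>W\<close>, and then a dual vector \<open>u\<close> is added.\<close>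
  obtain C where C: "{v} \<subseteq> C" "C \<subseteq> W" "independent C" "W \<subseteq> span C"
    by (rule maximal_independent_subset_extend[of "{v}" W])
      (use v_nonzero v_null in \<open>auto simp: W_def\<close>)
  obtain u where u: "g u v = 1" by (rule dual_vector)
  have "subspace W"
    by (auto simp: W_def subspace_def bilinear_ladd[OF g] bilinear_lmul[OF g] bilinear_lzero[OF g])
  then have "span C \<subseteq> W" using C(2) by (rule span_minimal[rotated])
  then have "u \<notin> span C" using u by (auto simp: W_def)
  then have "u \<notin> C" and indep: "independent (insert u C)"
    using C(3) by (auto intro: span_base simp: independent_insert)
  have "z \<in> span (insert u C)" for z
  proof -
    have "z - g z v *\<^sub>R u \<in> W"
      by (simp add: W_def bilinear_lsub[OF g] bilinear_lmul[OF g] u)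
    then show ?thesis using C(4) by (auto simp: span_breakdown_eq)
  qed
  then have span: "span (insert u C) = UNIV" by blast
  have "curvature br g b x y \<in> span (insert u C - {b})" if b: "b \<in> insert u C" for b
  proof -
    \<comment> \<open>The image of \<open>u\<close> lies in \<open>W\<close>, the span of
      \<open>C\<close>; \<open>v\<close> is sent to zero; any other \<open>b\<close> is sent to a
      multiple of the different basis vector \<open>v\<close>.\<close>
    consider "b = u" | "b = v" | "b \<in> C" "b \<noteq> v" "b \<noteq> u" using b by blast
    then show ?thesis
    proof cases
      case 1
      then show ?thesis
        using C(4) curvature_orth \<open>u \<notin> C\<close> by (auto simp: W_def)
    next
      case 2
      then show ?thesis by (simp add: curvature_v span_zero)
    next
      case 3
      then have "curvature br g b x y \<in> span {v}"
        using C(2) assms by (intro curvature_span) (auto simp: W_def)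
      moreover have "span {v} \<subseteq> span (insert u C - {b})"
        using C(1) 3 by (intro span_mono) auto
      ultimately show ?thesis by blast
    qed
  qed
  moreover have "\<exists>S::'g set. finite S \<and> span S = UNIV"
    using metric unfolding metric_lie_algebra_def lie_algebra_def by blast
  ultimately show ?thesis
    unfolding ricci_def by (intro endo_trace_eq_0[OF linear_curvature[OF metric] _ indep span])
qed

lemma ricci_parallel: "ricci_parallel br g"
  by (simp add: ricci_parallel_def ricci_eq_0 nabla_orth)

end

theorem corollary1p3:
  fixes br0 :: "'h::real_vector \<Rightarrow> 'h \<Rightarrow> 'h" and g0 :: "'h \<Rightarrow> 'h \<Rightarrow> real"
    and br :: "'g::real_vector \<Rightarrow> 'g \<Rightarrow> 'g" and g :: "'g \<Rightarrow> 'g \<Rightarrow> real"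
  assumes "metric_abelian_lie_algebra br0 g0"
    and "double_extension br0 g0 br g"
  shows "ricci_parallel br g"
proof -
  have br0: "br0 e e' = 0" for e e'
    using assms(1) by (simp add: metric_abelian_lie_algebra_def)
  have m: "metric_lie_algebra br g"
    using assms(2) by (simp add: double_extension_def)
  obtain D K L u v \<iota> where \<iota>: "linear \<iota>"
    and bij: "bij (\<lambda>(a::real, b::real, e::'h). a *\<^sub>R u + b *\<^sub>R v + \<iota> e)"
    and bru: "\<And>e. br u (\<iota> e) = \<iota> (D e) + g0 L e *\<^sub>R v"
    and bre: "\<And>e e'. br (\<iota> e) (\<iota> e') = \<iota> (br0 e e') + g0 (K e) e' *\<^sub>R v"
    and brv: "\<And>x. br x v = 0"
    and uv: "g u v = 1" and vv: "g v v = 0" and ve: "\<And>e. g v (\<iota> e) = 0"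
    using assms(2) unfolding double_extension_def by blast
  note br = metric_lie_algebraD(1)[OF m] and g = metric_lie_algebraD(2)[OF m]
  have ev: "g (\<iota> e) v = 0" for e using ve metric_lie_algebraD(4)[OF m] by metis
  have bree: "br (\<iota> e) (\<iota> e') = g0 (K e) e' *\<^sub>R v" for e e'
    \<comment> \<open>Here commutativity of the base algebra enters: only the
      \<open>v\<close>-component of the bracket survives.\<close>
    by (simp add: bre br0 linear_0[OF \<iota>])
  have breu: "br (\<iota> e) u = - (\<iota> (D e) + g0 L e *\<^sub>R v)" for e
    by (simp add: bracket_skew[OF m, of "\<iota> e" u] bru)
  have brv': "br v x = 0" for x using bracket_skew[OF m, of v x] brv by simp
  have decomp: "\<exists>a b e. x = a *\<^sub>R u + b *\<^sub>R v + \<iota> e" for x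
    using surjD[OF bij_is_surj[OF bij], of x] by auto
  note expand = bilinear_ladd[OF br] bilinear_radd[OF br] bilinear_lmul[OF br] bilinear_rmul[OF br]
    bilinear_ladd[OF g] bilinear_lmul[OF g] bilinear_lneg[OF g]
    metric_lie_algebraD(3)[OF m] bree bru breu brv brv' ev vv uv bilinear_lzero[OF g]
  interpret central_null_vector br g v
  proof
    show "v \<noteq> 0" using uv by (auto simp: bilinear_rzero[OF g])
    show "g (br x y) v = 0" for x y
    proof -
      obtain a b e a' b' e' where
        "x = a *\<^sub>R u + b *\<^sub>R v + \<iota> e" "y = a' *\<^sub>R u + b' *\<^sub>R v + \<iota> e'"
        using decomp by metis
      then show ?thesis by (simp add: expand bilinear_lsub[OF g])
    qed
    show "br x y \<in> span {v}" if "g x v = 0" "g y v = 0" for x y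
    proof -
      obtain a b e a' b' e' where
        "x = a *\<^sub>R u + b *\<^sub>R v + \<iota> e" "y = a' *\<^sub>R u + b' *\<^sub>R v + \<iota> e'"
        using decomp by metis
      \<comment> \<open>Pairing with \<open>v\<close> reads off the \<open>u\<close>-coefficient, so
        \<open>a\<close> and \<open>a'\<close> are zero and only the bracket from
        \<open>bree\<close> remains.\<close>
      with that show ?thesis by (simp add: expand span_scale span_base)
    qed
  qed (use m vv brv in auto)
  show ?thesis by (rule ricci_parallel)
qed

end
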